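(* Let $b$ be a graph over $(X,m)$ with $m(X)<\infty$ and let $p\in(1,\infty)$. Suppose there is a non-constant weak solution $f\in D_p$ for $\lambda^{(1)}_p$. Then $$\frac{2^{p-1}}{p^{p}}\,\bigl(h^{(1)}_{p}\bigr)^{p}\leq \lambda^{(1)}_{p}.$$
   Context: Setting: $X$ is a nonempty countable (finite or infinite) set and $C(X)$ is the space of real-valued functions on $X$. A graph $b$ over $(X,m)$ consists of a symmetric function $b:X\times X\to[0,\infty)$ with $b(x,x)=0$ and $\sum_{y\in X}b(x,y)<\infty$ for all $x\in X$, and a function $m:X\to(0,\infty)$, extended to a measure on subsets by $m(W)=\sum_{x\in W}m(x)$. No connectedness or boundedness assumption is made. $\ell^p(X,m)$ is the space of $f\in C(X)$ with $\|f\|_{m,p}=\bigl(\sum_{x\in X}|f(x)|^p m(x)\bigr)^{1/p}<\infty$. Energy: $\mathcal{E}_p(f)=\frac12\sum_{x,y\in X}b(x,y)|f(x)-f(y)|^p\in[0,\infty]$ for $f\in C(X)$, $D_p=\{f\in\ell^p(X,m): \mathcal{E}_p(f)<\infty\}$, and (for $m(X)<\infty$) $$\lambda^{(1)}_p=\inf_{f\in\ell^p(X,m),\ f\text{ non-constant}}\ \frac{\mathcal{E}_p(f)}{\inf_{\gamma\in\mathbb{R}}\|f-\gamma\|_{m,p}^p}.$$ A function $f\in D_p$ is a weak solution for $\lambda\in\mathbb R$ if for all $g\in D_p$ $$\frac12\sum_{x,y\in X}b(x,y)|f(x)-f(y)|^{p-2}(f(x)-f(y))(g(x)-g(y))=\lambda\sum_{x\in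 X}|f(x)|^{p-2}f(x)g(x)m(x),$$ where $|t|^{p-2}t$ is read as $0$ for $t=0$. For $p\in(1,\infty)$, $R_p(b,m)$ is the set of all symmetric functions $d:X\times X\to[0,\infty)$ such that $\sum_{y\in X}b(x,y)d(x,y)^{p/(p-1)}\le m(x)$ for all $x\in X$. For $W\subseteq X$, $\partial W=W\times(X\setminus W)$, and for $d:X\times X\to[0,\infty)$, $|\partial W|_{bd}=\sum_{(x,y)\in\partial W}b(x,y)d(x,y)\in[0,\infty]$. The isoperimetric constants are $$h^{(1)}(d)=\inf_{\emptyset\ne W\subseteq X,\ m(W)\le m(X)/2}\frac{|\partial W|_{bd}}{m(W)},\qquad h^{(1)}_p=\sup_{d\in R_p(b,m)}h^{(1)}(d).$$ *)

theory Defs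
  imports "HOL-Analysis.Analysis"
begin

text \<open>
  The countable set of vertices is a type \<open>'a :: countable\<close>. Every sum of
  non-negative terms, and every infimum or supremum of such sums, is taken in
  \<^typ>\<open>ennreal\<close>, so the value \<open>\<infinity>\<close> is possible and \<open>Inf {} = \<infinity>\<close>.
\<close>

definition ennpowr :: "ennreal \<Rightarrow> real \<Rightarrow> ennreal"  (infixr \<open>ennpowr\<close> 80)
  where "x ennpowr r = (if x = \<infinity> then \<infinity> else ennreal (enn2real x powr r))"
  \<comment> \<open>only meaningful for \<open>r > 0\<close>\<close>

definition weighted_graph :: "('a::countable \<Rightarrow> 'a \<Rightarrow> real) \<Rightarrow> ('a \<Rightarrow> real) \<Rightarrow> bool"
  where "weighted_graph b m \<longleftrightarrow>
    (\<forall>x y. 0 \<le> b x y) \<and> (\<forall>x y. b x y = b y x) \<and> (\<forall>x. b x x = 0) \<and>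
    (\<forall>x. (\<lambda>y. b x y) summable_on UNIV) \<and> (\<forall>x. 0 < m x)"

definition vmeasure :: "('a::countable \<Rightarrow> real) \<Rightarrow> 'a set \<Rightarrow> ennreal"
  where "vmeasure m W = (\<Sum>\<^sub>\<infinity>x\<in>W. ennreal (m x))"

definition lp_norm :: "('a::countable \<Rightarrow> real) \<Rightarrow> real \<Rightarrow> ('a \<Rightarrow> real) \<Rightarrow> ennreal"
  where "lp_norm m p f = (\<Sum>\<^sub>\<infinity>x\<in>UNIV. ennreal (\<bar>f x\<bar> powr p * m x)) ennpowr (1 / p)"

definition lp_space :: "('a::countable \<Rightarrow> real) \<Rightarrow> real \<Rightarrow> ('a \<Rightarrow> real) set"
  where "lp_space m p = {f. lp_norm m p f < \<infinity>}"

definition energy :: "('a::countable \<Rightarrow> 'a \<Rightarrow> real) \<Rightarrow> real \<Rightarrow> ('a \<Rightarrow> real) \<Rightarrow> ennreal"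
  where "energy b p f =
    (1 / 2) * (\<Sum>\<^sub>\<infinity>(x, y)\<in>UNIV. ennreal (b x y * \<bar>f x - f y\<bar> powr p))"

definition energy_domain ::
    "('a::countable \<Rightarrow> 'a \<Rightarrow> real) \<Rightarrow> ('a \<Rightarrow> real) \<Rightarrow> real \<Rightarrow> ('a \<Rightarrow> real) set"
  where "energy_domain b m p = {f \<in> lp_space m p. energy b p f < \<infinity>}"

definition lambda1 :: "('a::countable \<Rightarrow> 'a \<Rightarrow> real) \<Rightarrow> ('a \<Rightarrow> real) \<Rightarrow> real \<Rightarrow> ennreal"
  where "lambda1 b m p =
    (INF f \<in> {f \<in> lp_space m p. \<not> f constant_on UNIV}.
       energy b p f / (INF \<gamma>::real. lp_norm m p (\<lambda>x. f x - \<gamma>) ennpowr p))"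

text \<open>
  For \<open>p > 1\<close> and \<open>f\<close>, \<open>g\<close> in the energy domain, both sums below converge
  absolutely by Hoelder's inequality, so the default value of \<^const>\<open>infsum\<close> for
  non-summable families plays no role. If a non-constant \<open>f\<close> lies in the energy
  domain, its quotient is finite, hence \<open>lambda1 b m p < \<infinity>\<close> and \<^const>\<open>enn2real\<close> of it
  is the same number.
\<close>

definition weak_solution ::
    "('a::countable \<Rightarrow> 'a \<Rightarrow> real) \<Rightarrow> ('a \<Rightarrow> real) \<Rightarrow> real \<Rightarrow> real \<Rightarrow> ('a \<Rightarrow> real) \<Rightarrow> bool"
  where "weak_solution b m p lam f \<longleftrightarrow>
    f \<in> energy_domain b m p \<and>
    (\<forall>g \<in> energy_domain b m p.
       1 / 2 * (\<Sum>\<^sub>\<infinity>(x, y)\<in>UNIV.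
          b x y * (\<bar>f x - f y\<bar> powr (p - 2) * (f x - f y)) * (g x - g y)) =
       lam * (\<Sum>\<^sub>\<infinity>x\<in>UNIV. \<bar>f x\<bar> powr (p - 2) * f x * g x * m x))"

definition R_weights ::
    "('a::countable \<Rightarrow> 'a \<Rightarrow> real) \<Rightarrow> ('a \<Rightarrow> real) \<Rightarrow> real \<Rightarrow> ('a \<Rightarrow> 'a \<Rightarrow> real) set"
  where "R_weights b m p =
    {d. (\<forall>x y. 0 \<le> d x y) \<and> (\<forall>x y. d x y = d y x) \<and>
        (\<forall>x. (\<Sum>\<^sub>\<infinity>y\<in>UNIV. ennreal (b x y * d x y powr (p / (p - 1)))) \<le> ennreal (m x))}"

definition edge_boundary :: "'a set \<Rightarrow> ('a \<times> 'a) set"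
  where "edge_boundary W = W \<times> (UNIV - W)"

definition boundary_size ::
    "('a::countable \<Rightarrow> 'a \<Rightarrow> real) \<Rightarrow> ('a \<Rightarrow> 'a \<Rightarrow> real) \<Rightarrow> 'a set \<Rightarrow> ennreal"
  where "boundary_size b d W = (\<Sum>\<^sub>\<infinity>(x, y)\<in>edge_boundary W. ennreal (b x y * d x y))"

definition h1 ::
    "('a::countable \<Rightarrow> 'a \<Rightarrow> real) \<Rightarrow> ('a \<Rightarrow> real) \<Rightarrow> ('a \<Rightarrow> 'a \<Rightarrow> real) \<Rightarrow> ennreal"
  where "h1 b m d =
    (INF W \<in> {W. W \<noteq> {} \<and> vmeasure m W \<le> vmeasure m UNIV / 2}.
       boundary_size b d W / vmeasure m W)"

definition h1p :: "('a::countable \<Rightarrow> 'a \<Rightarrow> real) \<Rightarrow> ('a \<Rightarrow> real) \<Rightarrow> real \<Rightarrow> ennreal"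
  where "h1p b m p = (SUP d \<in> R_weights b m p. h1 b m d)"

end

theory Submission
  imports Defs
begin

text \<open>
  Testing the weak equation with the constant \<open>1\<close> shows that \<open>f\<close> changes sign if \<open>\<lambda> > 0\<close>; after
  replacing \<open>f\<close> by \<open>-f\<close>, the set \<open>{f > 0}\<close> carries at most half of the mass. Testing with
  \<open>u = f\<^sup>+\<close> gives \<open>E\<^sub>p(u) \<le> \<lambda> N\<close> where \<open>N\<close> is the \<open>p\<close>-th power of the norm of \<open>u\<close>. By the coarea
  formula, \<open>2 h N \<le> \<Sum> b d \<bar>u(x)\<^sup>p - u(y)\<^sup>p\<bar>\<close>. A pointwise Young inequality with a free scaling
  parameter \<open>s\<close> takes the place of Hoelder's inequality and bounds the right-hand side by
  \<open>2 s\<^sup>p E\<^sub>p(u) + (p - 1) s\<^bsup>-p/(p-1)\<^esup> N\<close>; choosing \<open>s\<close> optimally yields \<open>2 h \<le> p (2 \<lambda>)\<^bsup>1/p\<^esup>\<close>.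
  If \<open>\<lambda> = 0\<close>, then \<open>f\<close> has no energy, so one of its level sets or its complement is a set without
  boundary and \<open>h = 0\<close>.
\<close>

section \<open>Sums of non-negative terms\<close>

text \<open>In \<open>ennreal\<close>, \<open>infsum\<close> is the supremum of the finite partial
  sums, and an enumeration of \<open>A\<close> bounds the integral by it. Sums thereby inherit
  Tonelli, additivity and monotone comparison without summability conditions.\<close>

lemma infsum_eq_nn_integral_count_space:
  fixes f :: "'a \<Rightarrow> ennreal"
  assumes "countable A"
  shows "infsum f A = (\<integral>\<^sup>+x. f x \<partial>count_space A)"
proof -
  have sup: "infsum f A = (SUP F\<in>{F. finite F \<and> F \<subseteq> A}. sum f F)"
    by (rule nonneg_infsum_complete) simp
  have "sum f F \<le> (\<integral>\<^sup>+x. f x \<partial>count_space A)" if "finite F" "F \<subseteq> A" for F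
  proof -
    have "sum f F = (\<integral>\<^sup>+x. f x * indicator F x \<partial>count_space A)"
      using that by (subst nn_integral_count_space'[of F]) (auto simp: indicator_def)
    also have "\<dots> \<le> (\<integral>\<^sup>+x. f x \<partial>count_space A)"
      by (rule nn_integral_mono) (auto simp: indicator_def)
    finally show ?thesis .
  qed
  then have le: "infsum f A \<le> (\<integral>\<^sup>+x. f x \<partial>count_space A)"
    unfolding sup by (auto intro: SUP_least)
  have "(\<integral>\<^sup>+x. f x \<partial>count_space A) \<le> infsum f A"
  proof (cases "finite A")
    case True
    then show ?thesis by (simp add: nn_integral_count_space_finite)
  next
    case False
    have bij: "bij_betw (from_nat_into A) UNIV A"
      using assms False by (rule bij_betw_from_nat_into)
    have "(\<integral>\<^sup>+x. f x \<partial>count_space A) = (\<Sum>i. f (from_nat_into A i))"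
      by (simp add: nn_integral_bij_count_space[symmetric, OF bij] nn_integral_count_space_nat)
    also have "\<dots> = (SUP n. \<Sum>i<n. f (from_nat_into A i))"
      by (rule suminf_eq_SUP)
    also have "\<dots> \<le> infsum f A"
    proof (rule SUP_least)
      fix n
      have inj: "inj_on (from_nat_into A) {..<n}"
        using bij by (auto simp: bij_betw_def intro: inj_on_subset)
      have "(\<Sum>i<n. f (from_nat_into A i)) = sum f (from_nat_into A ` {..<n})"
        by (simp add: sum.reindex[OF inj])
      also have "\<dots> \<le> infsum f A"
        unfolding sup using bij by (intro SUP_upper) (auto simp: bij_betw_def)
      finally show "(\<Sum>i<n. f (from_nat_into A i)) \<le> infsum f A" .
    qed
    finally show ?thesis .
  qed
  with le show ?thesis by simp
qed

text \<open>The way back to real sums: the weak equation is written with the real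
  \<open>infsum\<close>, whose default value \<open>0\<close> has to be excluded. The finite partial
  sums are bounded by the finite total.\<close>

lemma summable_on_if_infsum_ennreal_finite:
  fixes f :: "'a \<Rightarrow> real"
  assumes nonneg: "\<And>x. x \<in> A \<Longrightarrow> 0 \<le> f x"
    and fin: "(\<Sum>\<^sub>\<infinity>x\<in>A. ennreal (f x)) < \<infinity>"
  shows "f summable_on A"
    and "ennreal (infsum f A) = (\<Sum>\<^sub>\<infinity>x\<in>A. ennreal (f x))"
proof -
  have sup: "(\<Sum>\<^sub>\<infinity>x\<in>A. ennreal (f x)) = (SUP F\<in>{F. finite F \<and> F \<subseteq> A}. ennreal (sum f F))"
    by (subst nonneg_infsum_complete)
      (auto intro!: SUP_cong sum_ennreal simp: nonneg subset_iff)
  have "sum f F \<le> enn2real (\<Sum>\<^sub>\<infinity>x\<in>A. ennreal (f x))" if "finite F" "F \<subseteq> A" for F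
  proof -
    have "ennreal (sum f F) \<le> (\<Sum>\<^sub>\<infinity>x\<in>A. ennreal (f x))"
      unfolding sup using that by (auto intro: SUP_upper)
    then have "enn2real (ennreal (sum f F)) \<le> enn2real (\<Sum>\<^sub>\<infinity>x\<in>A. ennreal (f x))"
      using fin by (intro enn2real_mono) auto
    then show ?thesis
      using that nonneg by (subst (asm) enn2real_ennreal) (auto intro!: sum_nonneg)
  qed
  then show "f summable_on A"
    by (intro nonneg_bdd_above_summable_on nonneg bdd_aboveI) auto
  then show "ennreal (infsum f A) = (\<Sum>\<^sub>\<infinity>x\<in>A. ennreal (f x))"
    unfolding sup by (rule infsum_nonneg_is_SUPREMUM_ennreal) (rule nonneg)
qed

section \<open>A pointwise Young inequality\<close>

text \<open>Young's inequality for \<open>A\<close> and \<open>B powr (p - 1)\<close> with the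
  exponents \<open>p\<close> and \<open>p / (p - 1)\<close>, multiplied by \<open>p\<close>.\<close>

lemma Young_powr:
  fixes p A B :: real
  assumes "1 < p" "0 \<le> A" "0 \<le> B"
  shows "p * A * B powr (p - 1) \<le> A powr p + (p - 1) * B powr p"
proof -
  have "A * B powr (p - 1) \<le> A powr p / p + (B powr (p - 1)) powr (p / (p - 1)) / (p / (p - 1))"
    using assms by (intro Youngs_inequality) (auto simp: field_simps)
  also have "(B powr (p - 1)) powr (p / (p - 1)) = B powr p"
    using assms by (simp add: powr_powr)
  finally have "p * (A * B powr (p - 1)) \<le> p * (A powr p / p + B powr p / (p / (p - 1)))"
    using assms by (intro mult_left_mono) auto
  also have "\<dots> = A powr p + (p - 1) * B powr p"
    using assms by (simp add: distrib_left)
  finally show ?thesis by (simp add: mult.assoc)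
qed

lemma has_real_derivative_powr_antiderivative:
  fixes r t :: real
  assumes "0 < t" "0 < r"
  shows "((\<lambda>x. x powr (r + 1) / (r + 1)) has_real_derivative t powr r) (at t)"
  using assms by (auto intro!: derivative_eq_intros)

lemma continuous_on_powr_nonneg:
  fixes r c a :: real
  assumes "0 \<le> c" "0 < r"
  shows "continuous_on {c..a} (\<lambda>t. t powr r)"
  using assms by (intro continuous_on_powr' continuous_on_id continuous_on_const) auto

text \<open>The trapezoidal rule overestimates the integral of the convex function
  \<open>t powr p\<close> over \<open>[c, a]\<close>. As a function of the upper endpoint, the error
  \<open>K\<close> vanishes at \<open>c\<close>, and \<open>Young_powr\<close> with
  \<open>A = c\<close>, \<open>B = t\<close> makes its derivative non-negative.\<close>

lemma Hermite_Hadamard_powr: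
  fixes p a c :: real
  assumes "1 < p" "0 \<le> c" "c \<le> a"
  shows "(a powr (p + 1) - c powr (p + 1)) / (p + 1) \<le> (a - c) * (a powr p + c powr p) / 2"
proof -
  define K where "K t = (t - c) * (t powr p + c powr p) / 2
    - (t powr (p + 1) / (p + 1) - c powr (p + 1) / (p + 1))" for t
  have "K c \<le> K a"
  proof (rule DERIV_nonneg_imp_increasing_open[OF assms(3)])
    fix t assume t: "c < t" "t < a"
    let ?D = "(t powr p + c powr p) / 2 + (t - c) * (p * t powr (p - 1)) / 2 - t powr p"
    have 1: "((\<lambda>t. (t - c) * (t powr p + c powr p) / 2) has_real_derivative
        (t powr p + c powr p) / 2 + (t - c) * (p * t powr (p - 1)) / 2) (at t)"
      using t assms by (auto intro!: derivative_eq_intros simp: add_divide_distrib)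
    have 2: "((\<lambda>t. t powr (p + 1) / (p + 1)) has_real_derivative t powr p) (at t)"
      using t assms by (intro has_real_derivative_powr_antiderivative) auto
    have "(K has_real_derivative ?D) (at t)"
      unfolding K_def using DERIV_diff[OF 1 DERIV_diff[OF 2 DERIV_const]] by simp
    moreover have "0 \<le> ?D"
    proof -
      have "t * t powr (p - 1) = t powr p" using t assms by (simp add: powr_diff)
      then show ?thesis
        using Young_powr[of p c t] t assms
          by (simp add: algebra_simps add_divide_distrib diff_divide_distrib)
    qed
    ultimately show "\<exists>y. (K has_real_derivative y) (at t) \<and> 0 \<le> y" by blast
  next
    show "continuous_on {c..a} K"
      unfolding K_def using assms
      by (intro continuous_on_diff continuous_on_add continuous_on_mult continuous_on_divide
          continuous_on_const continuous_on_id continuous_on_powr_nonneg) auto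
  qed
  then show ?thesis by (simp add: K_def diff_divide_distrib)
qed

text \<open>Averaging Young's inequality for \<open>p d t\<^bsup>p-1\<^esup> (a - c)\<close> over \<open>t \<in> [c, a]\<close>.\<close>

lemma powr_diff_Young_ordered:
  fixes p a c d s :: real
  assumes "1 < p" "0 \<le> c" "c \<le> a" "0 \<le> d" "0 < s"
  shows "d * (a powr p - c powr p) \<le>
    s powr p * (a - c) powr p + (p - 1) * (d / s) powr (p / (p - 1)) * ((a powr p + c powr p) / 2)"
proof (cases "a = c")
  case True
  then show ?thesis using assms by simp
next
  case False
  define D where "D = a - c"
  define e where "e = (d / s) powr (p / (p - 1))"
  have aD: "a = c + D" by (simp add: D_def)
  have D: "0 < D" using False assms by (simp add: D_def)
  have e: "0 \<le> e" by (simp add: e_def)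
  \<comment> \<open>\<open>H\<close> is an antiderivative of the gap in the scaled Young inequality
    at level \<open>t\<close>, so averaging that inequality over \<open>[c, a]\<close> amounts to
    \<open>H c \<le> H a\<close>.\<close>
  define H where "H t = s powr p * D powr p * t + (p - 1) * e * (t powr (p + 1) / (p + 1))
    - d * D * t powr p" for t
  have "H c \<le> H a"
  proof (rule DERIV_nonneg_imp_increasing_open[OF assms(3)])
    fix t assume t: "c < t" "t < a"
    let ?D = "s powr p * D powr p + (p - 1) * e * t powr p - d * D * (p * t powr (p - 1))"
    have 1: "((\<lambda>t. t powr p) has_real_derivative p * t powr (p - 1)) (at t)"
      using t assms by (auto intro!: derivative_eq_intros)
    have 2: "((\<lambda>t. s powr p * D powr p * t) has_real_derivative s powr p * D powr p) (at t)"
      by (auto intro!: derivative_eq_intros)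
    have 3: "((\<lambda>t. t powr (p + 1) / (p + 1)) has_real_derivative t powr p) (at t)"
      using t assms by (intro has_real_derivative_powr_antiderivative) auto
    have "(H has_real_derivative ?D) (at t)"
      unfolding H_def by (rule DERIV_diff[OF DERIV_add[OF 2 DERIV_cmult[OF 3]] DERIV_cmult[OF 1]])
    moreover have "0 \<le> ?D"
    proof -
      \<comment> \<open>Chosen so that Young's inequality with \<open>A = s * D\<close> has exactly
        \<open>p * d * D * t powr (p - 1)\<close> on its left.\<close>
      define B where "B = (d / s) powr (1 / (p - 1)) * t"
      have 1: "B powr (p - 1) = d / s * t powr (p - 1)"
        using t assms by (simp add: B_def powr_mult powr_powr)
      have 2: "B powr p = e * t powr p"
        using t assms by (simp add: B_def e_def powr_mult powr_powr)
      have "p * (s * D) * B powr (p - 1) \<le> (s * D) powr p + (p - 1) * B powr p"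
        using assms t D by (intro Young_powr) (auto simp: B_def)
      moreover have "p * (s * D) * B powr (p - 1) = d * D * (p * t powr (p - 1))"
        using assms by (simp add: 1)
      ultimately show ?thesis
        using assms D by (simp add: 2 powr_mult mult_ac)
    qed
    ultimately show "\<exists>y. (H has_real_derivative y) (at t) \<and> 0 \<le> y" by blast
  next
    show "continuous_on {c..a} H"
      unfolding H_def using assms
      by (intro continuous_on_diff continuous_on_add continuous_on_mult continuous_on_divide
          continuous_on_const continuous_on_id continuous_on_powr_nonneg) auto
  qed
  then have "D * (d * (a powr p - c powr p)) \<le> s powr p * D powr p * D
      + (p - 1) * e * ((a powr (p + 1) - c powr (p + 1)) / (p + 1))"
  proof -
    have "s powr p * D powr p * D = s powr p * D powr p * a - s powr p * D powr p * c"
      by (simp add: aD algebra_simps)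
    with \<open>H c \<le> H a\<close> show ?thesis
      by (simp add: H_def right_diff_distrib diff_divide_distrib mult_ac)
  qed
  \<comment> \<open>The trapezoidal bound gives each endpoint half of the weight, so that the
    constraint in \<open>R_weights\<close> can later be applied vertex by vertex.\<close>
  also have "\<dots> \<le> s powr p * D powr p * D + (p - 1) * e * (D * (a powr p + c powr p) / 2)"
    using Hermite_Hadamard_powr[OF assms(1-3)] e assms(1)
    unfolding D_def by (intro add_left_mono mult_left_mono) auto
  also have "\<dots> = D * (s powr p * D powr p + (p - 1) * e * ((a powr p + c powr p) / 2))"
    by (simp add: algebra_simps)
  finally show ?thesis
    using D by (simp add: D_def e_def)
qed

lemma powr_diff_Young:
  fixes p a c d s :: real
  assumes "1 < p" "0 \<le> a" "0 \<le> c" "0 \<le> d" "0 < s"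
  shows "d * \<bar>a powr p - c powr p\<bar> \<le> s powr p * \<bar>a - c\<bar> powr p
    + (p - 1) * (d / s) powr (p / (p - 1)) * ((a powr p + c powr p) / 2)"
proof (cases "c \<le> a")
  case True
  then have "c powr p \<le> a powr p" using assms by (intro powr_mono2) auto
  with True powr_diff_Young_ordered[of p c a d s] assms show ?thesis by simp
next
  case False
  then have "a powr p \<le> c powr p" using assms by (intro powr_mono2) auto
  with False powr_diff_Young_ordered[of p a c d s] assms show ?thesis by (simp add: add.commute)
qed

section \<open>Isoperimetry and the coarea formula\<close>

lemma vmeasure_eq_nn_integral:
  "vmeasure m W = (\<integral>\<^sup>+x. ennreal (m x) * indicator W x \<partial>count_space UNIV)"
  unfolding vmeasure_def
  by (simp add: infsum_eq_nn_integral_count_space nn_integral_count_space_indicator)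

lemma boundary_size_eq_nn_integral:
  "boundary_size b d W = (\<integral>\<^sup>+(x, y). ennreal (b x y * d x y) * indicator (W \<times> - W) (x, y)
     \<partial>count_space UNIV)"
  unfolding boundary_size_def edge_boundary_def
  by (simp add: infsum_eq_nn_integral_count_space nn_integral_count_space_indicator
      Compl_eq_Diff_UNIV case_prod_unfold)

lemma nn_integral_count_space_swap:
  "(\<integral>\<^sup>+(x, y). f x y \<partial>count_space UNIV) = (\<integral>\<^sup>+(x, y). f y x \<partial>count_space UNIV)"
  using nn_integral_fst_count_space[of "\<lambda>(x, y). f x y"]
    nn_integral_snd_count_space[of "\<lambda>(x, y). f y x"] by simp

text \<open>Two disjoint sets of more than half the mass would exceed the total. This serves both
  for the sets where \<open>f\<close> and \<open>-f\<close> are positive and for a level set and its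
  complement.\<close>

lemma vmeasure_disjoint_half:
  assumes "A \<inter> B = {}" "vmeasure m UNIV < \<infinity>"
  shows "vmeasure m A \<le> vmeasure m UNIV / 2 \<or> vmeasure m B \<le> vmeasure m UNIV / 2"
proof (rule ccontr)
  assume "\<not> ?thesis"
  then have "vmeasure m UNIV / 2 + vmeasure m UNIV / 2 < vmeasure m A + vmeasure m B"
    by (intro add_strict_mono) auto
  also have "vmeasure m A + vmeasure m B
      = (\<integral>\<^sup>+x. ennreal (m x) * indicator A x + ennreal (m x) * indicator B x \<partial>count_space UNIV)"
    unfolding vmeasure_eq_nn_integral by (simp add: nn_integral_add)
  also have "\<dots> \<le> vmeasure m UNIV"
    unfolding vmeasure_eq_nn_integral using assms(1)
    by (intro nn_integral_mono) (auto simp: indicator_def)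
  finally have "(vmeasure m UNIV * 2) / 2 < vmeasure m UNIV"
    by (simp add: add_divide_distrib_ennreal mult_2_right)
  then show False by (simp add: mult_divide_eq_ennreal)
qed

text \<open>The product form also covers the empty set, which the infimum excludes; empty level sets
  do occur in the coarea argument. For non-empty \<open>W\<close> the mass is positive and finite,
  so the division can be undone.\<close>

lemma h1_mult_vmeasure_le_boundary_size:
  assumes m: "\<And>x. 0 < m x" and fin: "vmeasure m UNIV < \<infinity>"
    and half: "vmeasure m W \<le> vmeasure m UNIV / 2"
  shows "h1 b m d * vmeasure m W \<le> boundary_size b d W"
proof (cases "W = {}")
  case True
  then show ?thesis by (simp add: vmeasure_def)
next
  case False
  then obtain x where x: "x \<in> W" by blast
  have "ennreal (m x) = (\<integral>\<^sup>+y. ennreal (m y) * indicator {x} y \<partial>count_space UNIV)"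
    by (simp add: nn_integral_count_space_indicator[symmetric] nn_integral_count_space_finite)
  also have "\<dots> \<le> vmeasure m W"
    unfolding vmeasure_eq_nn_integral using x by (intro nn_integral_mono) (auto simp: indicator_def)
  finally have pos: "0 < vmeasure m W"
    using m[of x] by (metis ennreal_less_zero_iff less_le_trans)
  have "vmeasure m W \<le> vmeasure m UNIV"
    unfolding vmeasure_eq_nn_integral by (intro nn_integral_mono) (auto simp: indicator_def)
  with fin have top: "vmeasure m W < top" by (simp add: le_less_trans)
  have "h1 b m d \<le> boundary_size b d W / vmeasure m W"
    unfolding h1_def using False half by (intro INF_lower) auto
  then have "h1 b m d * vmeasure m W \<le> boundary_size b d W / vmeasure m W * vmeasure m W"
    by (rule mult_right_mono) simp
  also have "\<dots> = boundary_size b d W"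
    using pos top by (simp add: ennreal_divide_times ennreal_mult_divide_eq less_top[symmetric])
  finally show ?thesis .
qed

text \<open>One formula for both sides of the coarea argument: \<open>c = 0\<close> recovers
  \<open>v x\<close> from its levels, and \<open>c = v y\<close> gives the positive part of
  \<open>v x - v y\<close>.\<close>

lemma nn_integral_level_sets:
  fixes a c :: real
  assumes "0 \<le> c"
  shows "(\<integral>\<^sup>+t. indicator {0..} t * indicator {c..<a} t \<partial>lborel) = ennreal (max 0 (a - c))"
proof -
  have "(\<integral>\<^sup>+t. indicator {0..} t * indicator {c..<a} t \<partial>lborel) = (\<integral>\<^sup>+t. indicator {c..<a} t \<partial>lborel)"
    using assms by (intro nn_integral_cong) (auto simp: indicator_def)
  also have "\<dots> = ennreal (max 0 (a - c))"
    by (cases "c \<le> a") (auto simp: max_def)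
  finally show ?thesis .
qed

text \<open>Integrate the isoperimetric inequality over the level sets \<open>{v > t}\<close>, \<open>t \<ge> 0\<close>.\<close>

lemma coarea_isoperimetric:
  fixes b d :: "'a::countable \<Rightarrow> 'a \<Rightarrow> real"
  assumes m: "\<And>x. 0 < m x" and fin: "vmeasure m UNIV < \<infinity>"
    and v: "\<And>x. 0 \<le> v x" and half: "vmeasure m {x. 0 < v x} \<le> vmeasure m UNIV / 2"
    and bd: "\<And>x y. 0 \<le> b x y * d x y"
  shows "h1 b m d * (\<integral>\<^sup>+x. ennreal (v x * m x) \<partial>count_space UNIV) \<le>
    (\<integral>\<^sup>+(x, y). ennreal (b x y * d x y * max 0 (v x - v y)) \<partial>count_space UNIV)"
proof -
  let ?W = "\<lambda>t. {x. t < v x}"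
  let ?h = "h1 b m d"
  \<comment> \<open>Layer-cake representation: \<open>v x\<close> is the length of the set of levels
    \<open>t \<ge> 0\<close> with \<open>t < v x\<close>. Tonelli then moves the integral over
    levels to the outside.\<close>
  have "?h * (\<integral>\<^sup>+x. ennreal (v x * m x) \<partial>count_space UNIV)
      = (\<integral>\<^sup>+x. \<integral>\<^sup>+t. ?h * ennreal (m x) * (indicator {0..} t * indicator {0..<v x} t) \<partial>lborel
          \<partial>count_space UNIV)"
    by (simp add: nn_integral_cmult nn_integral_level_sets v less_imp_le[OF m] ennreal_mult
        mult.assoc mult.commute[of "ennreal (v _)"])
  also have "\<dots> = (\<integral>\<^sup>+t. \<integral>\<^sup>+x. ?h * ennreal (m x) * (indicator {0..} t * indicator {0..<v x} t)
          \<partial>count_space UNIV \<partial>lborel)"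
    by (rule nn_integral_count_space_nn_integral[symmetric]) auto
  also have "\<dots> \<le> (\<integral>\<^sup>+t. \<integral>\<^sup>+(x, y). ennreal (b x y * d x y) *
          (indicator {0..} t * indicator {v y..<v x} t) \<partial>count_space UNIV \<partial>lborel)"
  proof (rule nn_integral_mono)
    fix t :: real
    show "(\<integral>\<^sup>+x. ?h * ennreal (m x) * (indicator {0..} t * indicator {0..<v x} t)
          \<partial>count_space UNIV) \<le> (\<integral>\<^sup>+(x, y). ennreal (b x y * d x y) *
          (indicator {0..} t * indicator {v y..<v x} t) \<partial>count_space UNIV)"
    proof (cases "0 \<le> t")
      case False
      then show ?thesis by simp
    next
      case True
      \<comment> \<open>For \<open>t \<ge> 0\<close> the level set lies in
        \<open>{x. 0 < v x}\<close>, hence is admissible in the definition of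
        \<open>h1\<close>.\<close>
      have "vmeasure m (?W t) \<le> vmeasure m (?W 0)"
        unfolding vmeasure_eq_nn_integral using True
        by (intro nn_integral_mono) (auto simp: indicator_def)
      then have "?h * vmeasure m (?W t) \<le> boundary_size b d (?W t)"
        using half by (intro h1_mult_vmeasure_le_boundary_size m fin) auto
      moreover have "?h * vmeasure m (?W t)
          = (\<integral>\<^sup>+x. ?h * ennreal (m x) * (indicator {0..} t * indicator {0..<v x} t)
          \<partial>count_space UNIV)"
        unfolding vmeasure_eq_nn_integral using True
        by (auto simp: indicator_def simp flip: nn_integral_cmult intro!: nn_integral_cong)
      \<comment> \<open>A pair \<open>(x, y)\<close> crosses the boundary of \<open>?W t\<close>
        exactly when \<open>v y \<le> t < v x\<close>.\<close>
      moreover have "boundary_size b d (?W t) = (\<integral>\<^sup>+(x, y). ennreal (b x y * d x y) *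
          (indicator {0..} t * indicator {v y..<v x} t) \<partial>count_space UNIV)"
        unfolding boundary_size_eq_nn_integral using True
        by (intro nn_integral_cong) (auto simp: indicator_def)
      ultimately show ?thesis by simp
    qed
  qed
  also have "\<dots> = (\<integral>\<^sup>+z. \<integral>\<^sup>+t. ennreal (b (fst z) (snd z) * d (fst z) (snd z)) *
          (indicator {0..} t * indicator {v (snd z)..<v (fst z)} t) \<partial>lborel \<partial>count_space UNIV)"
    unfolding case_prod_unfold by (rule nn_integral_count_space_nn_integral) auto
  also have "\<dots> = (\<integral>\<^sup>+(x, y). ennreal (b x y * d x y * max 0 (v x - v y)) \<partial>count_space UNIV)"
    by (intro nn_integral_cong)
      (simp add: case_prod_unfold nn_integral_cmult nn_integral_level_sets v bd ennreal_mult)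
  finally show ?thesis .
qed

text \<open>Exchanging \<open>x\<close> and \<open>y\<close> leaves the one-sided variation
  unchanged, and the two positive parts of \<open>v x - v y\<close> and \<open>v y - v x\<close> add
  up to the absolute value. This is the source of the factor \<open>2\<close>.\<close>

lemma coarea_isoperimetric_symmetric:
  fixes b d :: "'a::countable \<Rightarrow> 'a \<Rightarrow> real"
  assumes m: "\<And>x. 0 < m x" and fin: "vmeasure m UNIV < \<infinity>"
    and v: "\<And>x. 0 \<le> v x" and half: "vmeasure m {x. 0 < v x} \<le> vmeasure m UNIV / 2"
    and bd: "\<And>x y. 0 \<le> b x y * d x y" and sym: "\<And>x y. b x y = b y x" "\<And>x y. d x y = d y x"
  shows "2 * h1 b m d * (\<integral>\<^sup>+x. ennreal (v x * m x) \<partial>count_space UNIV) \<le>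
    (\<integral>\<^sup>+(x, y). ennreal (b x y * (d x y * \<bar>v x - v y\<bar>)) \<partial>count_space UNIV)"
proof -
  let ?I = "\<integral>\<^sup>+(x, y). ennreal (b x y * d x y * max 0 (v x - v y)) \<partial>count_space UNIV"
  have "?I = (\<integral>\<^sup>+(x, y). ennreal (b x y * d x y * max 0 (v y - v x)) \<partial>count_space UNIV)"
    by (subst nn_integral_count_space_swap) (simp add: sym[symmetric] sym)
  then have "?I + ?I = (\<integral>\<^sup>+(x, y). ennreal (b x y * d x y * max 0 (v x - v y)) \<partial>count_space UNIV)
     + (\<integral>\<^sup>+(x, y). ennreal (b x y * d x y * max 0 (v y - v x)) \<partial>count_space UNIV)"
    by simp
  also have "\<dots> = (\<integral>\<^sup>+(x, y). ennreal (b x y * (d x y * \<bar>v x - v y\<bar>)) \<partial>count_space UNIV)"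
    by (subst nn_integral_add[symmetric])
      (auto simp: bd max_def simp flip: ennreal_plus mult.assoc intro!: nn_integral_cong)
  finally have eq: "?I + ?I
      = (\<integral>\<^sup>+(x, y). ennreal (b x y * (d x y * \<bar>v x - v y\<bar>)) \<partial>count_space UNIV)" .
  have le: "h1 b m d * (\<integral>\<^sup>+x. ennreal (v x * m x) \<partial>count_space UNIV) \<le> ?I"
    by (rule coarea_isoperimetric[OF m fin v half bd])
  show ?thesis
    using add_mono[OF le le] by (simp only: mult_2 distrib_right eq)
qed

section \<open>Variation and energy\<close>

text \<open>Here the normalisation in \<open>R_weights\<close> enters: the sum over \<open>y\<close>
  is at most \<open>m x\<close>, and the factor \<open>v x\<close> does not depend on
  \<open>y\<close>.\<close>

lemma nn_integral_R_weights_le: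
  fixes b d :: "'a::countable \<Rightarrow> 'a \<Rightarrow> real"
  assumes b: "\<And>x y. 0 \<le> b x y" and v: "\<And>x. 0 \<le> v x"
    and d: "d \<in> R_weights b m p" and m: "\<And>x. 0 \<le> m x"
  shows "(\<integral>\<^sup>+x. \<integral>\<^sup>+y. ennreal (b x y * d x y powr (p / (p - 1)) * v x)
    \<partial>count_space UNIV \<partial>count_space UNIV) \<le> (\<integral>\<^sup>+x. ennreal (v x * m x) \<partial>count_space UNIV)"
proof (rule nn_integral_mono)
  fix x
  have "(\<integral>\<^sup>+y. ennreal (b x y * d x y powr (p / (p - 1))) \<partial>count_space UNIV) \<le> ennreal (m x)"
    using d unfolding R_weights_def infsum_eq_nn_integral_count_space[OF countableI_type] by blast
  then have "(\<integral>\<^sup>+y. ennreal (b x y * d x y powr (p / (p - 1))) \<partial>count_space UNIV) * ennreal (v x)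
      \<le> ennreal (m x) * ennreal (v x)"
    by (rule mult_right_mono) simp
  then show "(\<integral>\<^sup>+y. ennreal (b x y * d x y powr (p / (p - 1)) * v x) \<partial>count_space UNIV)
      \<le> ennreal (v x * m x)"
    using b v m by (simp add: nn_integral_cmult ennreal_mult mult.commute)
qed

text \<open>The inequality \<open>powr_diff_Young\<close> is multiplied by \<open>b x y\<close> and
  summed. Each of the two endpoint terms is bounded by the norm term, the second one by symmetry,
  and each carries half of the constant.\<close>

lemma weighted_variation_le:
  fixes b d :: "'a::countable \<Rightarrow> 'a \<Rightarrow> real"
  assumes graph: "weighted_graph b m" and p: "1 < p" and s: "0 < s"
    and u: "\<And>x. 0 \<le> u x" and d: "d \<in> R_weights b m p"
  shows "(\<integral>\<^sup>+(x, y). ennreal (b x y * (d x y * \<bar>u x powr p - u y powr p\<bar>)) \<partial>count_space UNIV) \<le>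
    ennreal (s powr p) * (\<integral>\<^sup>+(x, y). ennreal (b x y * \<bar>u x - u y\<bar> powr p) \<partial>count_space UNIV) +
    ennreal ((p - 1) / s powr (p / (p - 1))) *
      (\<integral>\<^sup>+x. ennreal (u x powr p * m x) \<partial>count_space UNIV)"
    (is "?L \<le> ennreal (s powr p) * ?E + ennreal ?c * ?N")
proof -
  let ?q = "p / (p - 1)"
  have b: "0 \<le> b x y" "b x y = b y x" and m: "0 \<le> m x" for x y
    using graph by (auto simp: weighted_graph_def less_imp_le)
  have dd: "0 \<le> d x y" "d x y = d y x" for x y
    using d by (auto simp: R_weights_def)
  have c: "0 \<le> ?c" using p by simp
  let ?w = "\<lambda>x y. b x y * d x y powr ?q"
  have 1: "(\<integral>\<^sup>+(x, y). ennreal (?w x y * u x powr p) \<partial>count_space UNIV) \<le> ?N"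
    using nn_integral_R_weights_le[OF b(1) _ d m, of "\<lambda>x. u x powr p"]
      nn_integral_fst_count_space[of "\<lambda>(x, y). ennreal (?w x y * u x powr p)"] by simp
  have 2: "(\<integral>\<^sup>+(x, y). ennreal (?w x y * u y powr p) \<partial>count_space UNIV) \<le> ?N"
    using 1 by (subst nn_integral_count_space_swap) (simp add: b(2)[symmetric] dd(2)[symmetric])
  have "?L \<le> (\<integral>\<^sup>+(x, y). ennreal (s powr p) * ennreal (b x y * \<bar>u x - u y\<bar> powr p)
      + (ennreal (?c / 2) * ennreal (?w x y * u x powr p)
       + ennreal (?c / 2) * ennreal (?w x y * u y powr p)) \<partial>count_space UNIV)"
  proof (intro nn_integral_mono, clarify)
    fix x y
    have "b x y * (d x y * \<bar>u x powr p - u y powr p\<bar>) \<le> b x y * (s powr p * \<bar>u x - u y\<bar> powr p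
      + (p - 1) * (d x y / s) powr ?q * ((u x powr p + u y powr p) / 2))"
      using p s u b(1) dd(1) by (intro mult_left_mono powr_diff_Young) auto
    also have "(d x y / s) powr ?q = d x y powr ?q / s powr ?q"
      using dd(1) s by (simp add: powr_divide)
    also have "b x y * (s powr p * \<bar>u x - u y\<bar> powr p
        + (p - 1) * (d x y powr ?q / s powr ?q) * ((u x powr p + u y powr p) / 2)) =
      s powr p * (b x y * \<bar>u x - u y\<bar> powr p)
       + (?c / 2 * (?w x y * u x powr p) + ?c / 2 * (?w x y * u y powr p))"
      by (simp add: algebra_simps add_divide_distrib diff_divide_distrib)
    finally have "ennreal (b x y * (d x y * \<bar>u x powr p - u y powr p\<bar>)) \<le> ennreal \<dots>"
      by (rule ennreal_leI)
    also have "\<dots> = ennreal (s powr p) * ennreal (b x y * \<bar>u x - u y\<bar> powr p)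
      + (ennreal (?c / 2) * ennreal (?w x y * u x powr p)
       + ennreal (?c / 2) * ennreal (?w x y * u y powr p))"
    proof -
      have nn: "0 \<le> s powr p * (b x y * \<bar>u x - u y\<bar> powr p)"
        "0 \<le> ?c / 2 * (?w x y * u x powr p)" "0 \<le> ?c / 2 * (?w x y * u y powr p)"
        using c b(1) by (intro mult_nonneg_nonneg; simp)+
      show ?thesis
        unfolding ennreal_plus[OF nn(1) add_nonneg_nonneg[OF nn(2,3)]] ennreal_plus[OF nn(2,3)]
        using c b(1) by (intro arg_cong2[where f = "(+)"] ennreal_mult) auto
    qed
    finally show "ennreal (b x y * (d x y * \<bar>u x powr p - u y powr p\<bar>)) \<le> \<dots>" .
  qed
  also have "\<dots> = ennreal (s powr p) * ?E
      + (ennreal (?c / 2) * (\<integral>\<^sup>+(x, y). ennreal (?w x y * u x powr p) \<partial>count_space UNIV)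
       + ennreal (?c / 2) * (\<integral>\<^sup>+(x, y). ennreal (?w x y * u y powr p) \<partial>count_space UNIV))"
    by (simp add: case_prod_unfold nn_integral_add nn_integral_cmult)
  also have "\<dots> \<le> ennreal (s powr p) * ?E + (ennreal (?c / 2) * ?N + ennreal (?c / 2) * ?N)"
    by (intro add_left_mono add_mono mult_left_mono 1 2) auto
  also have "ennreal (?c / 2) * ?N + ennreal (?c / 2) * ?N = (ennreal (?c / 2) + ennreal (?c / 2)) * ?N"
    by (simp only: distrib_right)
  also have "ennreal (?c / 2) + ennreal (?c / 2) = ennreal ?c"
    using c by (subst ennreal_plus[symmetric]) auto
  finally show ?thesis .
qed

text \<open>The weighted variation of \<open>u powr p\<close> is bounded below by the coarea
  inequality and above by Young's inequality; comparing the two and cancelling \<open>N\<close>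
  leaves a bound on \<open>h1\<close>.\<close>

lemma h1_le_of_energy_bound:
  fixes b d :: "'a::countable \<Rightarrow> 'a \<Rightarrow> real"
  assumes graph: "weighted_graph b m" and fin: "vmeasure m UNIV < \<infinity>" and p: "1 < p"
    and lam: "0 < lam" and u: "\<And>x. 0 \<le> u x" and d: "d \<in> R_weights b m p"
    and half: "vmeasure m {x. 0 < u x} \<le> vmeasure m UNIV / 2"
    and N: "(\<Sum>\<^sub>\<infinity>x. ennreal (u x powr p * m x)) \<noteq> 0" "(\<Sum>\<^sub>\<infinity>x. ennreal (u x powr p * m x)) \<noteq> \<infinity>"
    and en: "(\<Sum>\<^sub>\<infinity>(x, y)\<in>UNIV. ennreal (b x y * \<bar>u x - u y\<bar> powr p)) \<le>
      ennreal (2 * lam) * (\<Sum>\<^sub>\<infinity>x. ennreal (u x powr p * m x))"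
  shows "h1 b m d \<le> ennreal (p / 2 * (2 * lam) powr (1 / p))"
proof -
  let ?q = "p / (p - 1)"
  define r where "r = (2 * lam) powr (1 / p)"
  \<comment> \<open>The minimiser of \<open>s powr p * (2 * lam) + (p - 1) * s powr (- ?q)\<close>,
    found from \<open>s powr (p + ?q) = 1 / (2 * lam)\<close> and \<open>p + ?q = p * ?q\<close>.
    The two terms become \<open>r\<close> and \<open>(p - 1) * r\<close>, with sum
    \<open>p * r\<close>.\<close>
  define s where "s = (2 * lam) powr (- 1 / (p * ?q))"
  define N where "N = (\<integral>\<^sup>+x. ennreal (u x powr p * m x) \<partial>count_space UNIV)"
  have N': "N \<noteq> 0" "N \<noteq> top"
    using N by (auto simp: N_def infsum_eq_nn_integral_count_space)
  have b: "0 \<le> b x y" "b x y = b y x" and m: "0 < m x" for x y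
    using graph by (auto simp: weighted_graph_def)
  have dd: "0 \<le> d x y" "d x y = d y x" for x y
    using d by (auto simp: R_weights_def)
  have s: "0 < s" using lam by (simp add: s_def)
  have s1: "s powr p * (2 * lam) = r"
  proof -
    have "s powr p * (2 * lam) = (2 * lam) powr (- 1 / ?q) * (2 * lam) powr 1"
      using lam p by (simp add: s_def powr_powr)
    also have "\<dots> = (2 * lam) powr (- 1 / ?q + 1)" by (simp only: powr_add)
    also have "- 1 / ?q + 1 = 1 / p" using p by (simp add: field_simps)
    finally show ?thesis by (simp add: r_def)
  qed
  have s2: "(p - 1) / s powr ?q = (p - 1) * r"
  proof -
    have "s powr ?q = (2 * lam) powr (- (1 / p))"
    proof -
      have "- 1 / (p * ?q) * ?q = - (1 / p)" using p by (simp add: field_simps)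
      then show ?thesis by (simp only: s_def powr_powr)
    qed
    then show ?thesis by (simp add: r_def powr_minus_divide)
  qed
  \<comment> \<open>The coarea inequality for \<open>v = u powr p\<close>, which is positive exactly
    where \<open>u\<close> is.\<close>
  have "2 * h1 b m d * N \<le>
      (\<integral>\<^sup>+(x, y). ennreal (b x y * (d x y * \<bar>u x powr p - u y powr p\<bar>)) \<partial>count_space UNIV)"
    unfolding N_def
    using half b dd u m p by (intro coarea_isoperimetric_symmetric fin) (auto simp: less_le)
  also have "\<dots> \<le> ennreal (s powr p) *
      (\<integral>\<^sup>+(x, y). ennreal (b x y * \<bar>u x - u y\<bar> powr p) \<partial>count_space UNIV)
      + ennreal ((p - 1) / s powr ?q) * N"
    unfolding N_def by (rule weighted_variation_le[OF graph p s u d])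
  also have "\<dots> \<le> ennreal (s powr p) * (ennreal (2 * lam) * N) + ennreal ((p - 1) / s powr ?q) * N"
    using en by (intro add_right_mono mult_left_mono)
      (auto simp: N_def infsum_eq_nn_integral_count_space)
  also have "\<dots> = ennreal (p * r) * N"
  proof -
    have "ennreal (s powr p) * (ennreal (2 * lam) * N) = ennreal r * N"
      using lam by (simp add: s1[symmetric] ennreal_mult mult.assoc)
    moreover have "ennreal r + ennreal ((p - 1) * r) = ennreal (p * r)"
    proof -
      have "ennreal (p * r) = ennreal (r + (p - 1) * r)" by (simp add: algebra_simps)
      also have "\<dots> = ennreal r + ennreal ((p - 1) * r)"
        using p by (intro ennreal_plus) (auto simp: r_def)
      finally show ?thesis by simp
    qed
    ultimately show ?thesis by (simp only: s2 distrib_right[symmetric])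
  qed
  finally have "2 * h1 b m d * N / N \<le> ennreal (p * r) * N / N"
    by (rule divide_right_mono_ennreal)
  then have le: "2 * h1 b m d \<le> ennreal (p * r)"
    using N' by (simp add: mult_divide_eq_ennreal)
  then have "h1 b m d * 2 / 2 \<le> ennreal (p * r) / 2"
    by (intro divide_right_mono_ennreal) (simp add: mult.commute)
  also have "h1 b m d * 2 / 2 = h1 b m d"
    by (simp add: mult_divide_eq_ennreal)
  also have "ennreal (p * r) / 2 = ennreal (p / 2 * (2 * lam) powr (1 / p))"
    using p divide_ennreal[of "p * r" 2] by (simp add: r_def)
  finally show ?thesis .
qed

section \<open>Weak solutions\<close>

lemma lp_space_iff:
  "f \<in> lp_space m p \<longleftrightarrow> (\<Sum>\<^sub>\<infinity>x. ennreal (\<bar>f x\<bar> powr p * m x)) < \<infinity>"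
  by (auto simp: lp_space_def lp_norm_def ennpowr_def less_top)

lemma energy_finite_iff:
  "energy b p f < \<infinity> \<longleftrightarrow> (\<Sum>\<^sub>\<infinity>(x, y)\<in>UNIV. ennreal (b x y * \<bar>f x - f y\<bar> powr p)) < \<infinity>"
proof -
  have "(1 / 2 :: ennreal) < top"
    by (simp add: less_top[symmetric] ennreal_divide_eq_top_iff)
  then show ?thesis by (auto simp: energy_def ennreal_mult_less_top)
qed

lemma energy_domain_iff:
  "f \<in> energy_domain b m p \<longleftrightarrow> (\<Sum>\<^sub>\<infinity>x. ennreal (\<bar>f x\<bar> powr p * m x)) < \<infinity> \<and>
     (\<Sum>\<^sub>\<infinity>(x, y)\<in>UNIV. ennreal (b x y * \<bar>f x - f y\<bar> powr p)) < \<infinity>"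
  by (simp only: energy_domain_def lp_space_iff energy_finite_iff mem_Collect_eq)

text \<open>Every term of both sums decreases under a normal contraction. In particular the positive
  part of a weak solution may serve as a test function.\<close>

lemma energy_domain_contraction:
  assumes f: "f \<in> energy_domain b m p" and p: "0 \<le> p"
    and b: "\<And>x y. 0 \<le> b x y" and m: "\<And>x. 0 \<le> m x"
    and le: "\<And>x. \<bar>g x\<bar> \<le> \<bar>f x\<bar>" "\<And>x y. \<bar>g x - g y\<bar> \<le> \<bar>f x - f y\<bar>"
  shows "g \<in> energy_domain b m p"
proof -
  have "(\<Sum>\<^sub>\<infinity>x. ennreal (\<bar>g x\<bar> powr p * m x)) \<le> (\<Sum>\<^sub>\<infinity>x. ennreal (\<bar>f x\<bar> powr p * m x))"
    using p m le unfolding infsum_eq_nn_integral_count_space[OF countableI_type]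
    by (intro nn_integral_mono) (auto intro!: ennreal_leI mult_right_mono powr_mono2)
  moreover have "(\<Sum>\<^sub>\<infinity>(x, y)\<in>UNIV. ennreal (b x y * \<bar>g x - g y\<bar> powr p))
      \<le> (\<Sum>\<^sub>\<infinity>(x, y)\<in>UNIV. ennreal (b x y * \<bar>f x - f y\<bar> powr p))"
    using p b le unfolding infsum_eq_nn_integral_count_space[OF countableI_type]
    by (intro nn_integral_mono) (auto intro!: ennreal_leI mult_left_mono powr_mono2)
  ultimately show ?thesis
    using f unfolding energy_domain_iff by (meson le_less_trans)
qed

text \<open>Constants have finite norm because the total mass is finite. Testing with
  \<open>1\<close> makes the left side of the weak equation vanish.\<close>

lemma const_in_energy_domain:
  assumes "vmeasure m UNIV < \<infinity>"
  shows "(\<lambda>_. 1) \<in> energy_domain b m p"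
  using assms by (simp add: energy_domain_iff vmeasure_def case_prod_unfold)

text \<open>Both sides of the weak equation are odd in \<open>f\<close>. This permits the passage to
  \<open>-f\<close> when the set where \<open>f\<close> is positive is too heavy.\<close>

lemma weak_solution_uminus:
  assumes "weak_solution b m p lam f"
  shows "weak_solution b m p lam (\<lambda>x. - f x)"
proof -
  have dom: "(\<lambda>x. - f x) \<in> energy_domain b m p"
    using assms by (simp add: weak_solution_def energy_domain_iff abs_minus_commute)
  have "1 / 2 * (\<Sum>\<^sub>\<infinity>(x, y)\<in>UNIV.
          b x y * (\<bar>- f x - - f y\<bar> powr (p - 2) * (- f x - - f y)) * (g x - g y)) =
       lam * (\<Sum>\<^sub>\<infinity>x\<in>UNIV. \<bar>- f x\<bar> powr (p - 2) * - f x * g x * m x)"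
    if "g \<in> energy_domain b m p" for g
  proof -
    have 1: "b x y * (\<bar>- f x - - f y\<bar> powr (p - 2) * (- f x - - f y)) * (g x - g y)
        = - (b x y * (\<bar>f x - f y\<bar> powr (p - 2) * (f x - f y)) * (g x - g y))" for x y
      by (simp add: abs_minus_commute algebra_simps)
    have 2: "\<bar>- f x\<bar> powr (p - 2) * - f x * g x * m x = - (\<bar>f x\<bar> powr (p - 2) * f x * g x * m x)" for x
      by simp
    show ?thesis
      unfolding 1 2 case_prod_unfold infsum_uminus
      using assms that by (simp add: weak_solution_def case_prod_unfold)
  qed
  with dom show ?thesis unfolding weak_solution_def by blast
qed

section \<open>Testing the weak equation\<close>

lemma abs_powr_diff2_mult:
  fixes t p :: real
  shows "\<bar>t\<bar> powr (p - 2) * t * t = \<bar>t\<bar> powr p"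
proof (cases "t = 0")
  case False
  then have "\<bar>t\<bar> powr (p - 2) * t\<^sup>2 = \<bar>t\<bar> powr (p - 2) * \<bar>t\<bar> powr 2"
    by simp
  also have "\<dots> = \<bar>t\<bar> powr p" by (simp only: powr_add[symmetric]) simp
  finally show ?thesis by (simp add: power2_eq_square mult.assoc)
qed simp

text \<open>With \<open>t = a - c\<close>, the difference of positive parts is \<open>k * t\<close>
  for some \<open>k\<close> in \<open>[0, 1]\<close>, so the middle term is
  \<open>k * \<bar>t\<bar> powr p\<close>, and \<open>k powr p \<le> k \<le> 1\<close>. The first
  bound compares energies, the second provides summability.\<close>

lemma positive_part_powr_bounds:
  fixes a c p :: real
  assumes "1 < p"
  shows "\<bar>max 0 a - max 0 c\<bar> powr p \<le> \<bar>a - c\<bar> powr (p - 2) * (a - c) * (max 0 a - max 0 c)"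
    and "\<bar>a - c\<bar> powr (p - 2) * (a - c) * (max 0 a - max 0 c) \<le> \<bar>a - c\<bar> powr p"
proof -
  define t where "t = a - c"
  define k where "k = (if t = 0 then 0 else (max 0 a - max 0 c) / t)"
  have k: "max 0 a - max 0 c = k * t" "0 \<le> k" "k \<le> 1"
    by (auto simp: k_def t_def max_def field_simps)
  have eq: "\<bar>a - c\<bar> powr (p - 2) * (a - c) * (max 0 a - max 0 c) = k * \<bar>t\<bar> powr p"
    unfolding k(1) t_def[symmetric] using abs_powr_diff2_mult[of t p] by (simp add: mult_ac)
  have "k powr p \<le> k powr 1" using k assms by (intro powr_mono') auto
  then show "\<bar>max 0 a - max 0 c\<bar> powr p \<le> \<bar>a - c\<bar> powr (p - 2) * (a - c) * (max 0 a - max 0 c)"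
    unfolding eq unfolding k(1) using k by (simp add: abs_mult powr_mult mult_right_mono)
  show "\<bar>a - c\<bar> powr (p - 2) * (a - c) * (max 0 a - max 0 c) \<le> \<bar>a - c\<bar> powr p"
    unfolding eq unfolding t_def[symmetric] using k by (simp add: mult_left_le_one_le)
qed

text \<open>The weak equation is tested with \<open>?u\<close>. Its left side dominates the energy
  of \<open>?u\<close> term by term; the factor \<open>1 / 2\<close> there accounts for
  \<open>2 * lam\<close>.\<close>

lemma weak_solution_positive_part_energy:
  assumes graph: "weighted_graph b m" and p: "1 < p" and lam: "0 \<le> lam"
    and ws: "weak_solution b m p lam f"
  shows "(\<Sum>\<^sub>\<infinity>(x, y)\<in>UNIV. ennreal (b x y * \<bar>max 0 (f x) - max 0 (f y)\<bar> powr p)) \<le>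
      ennreal (2 * lam) * (\<Sum>\<^sub>\<infinity>x. ennreal (max 0 (f x) powr p * m x))"
    and "(\<Sum>\<^sub>\<infinity>x. ennreal (max 0 (f x) powr p * m x)) < \<infinity>"
proof -
  let ?u = "\<lambda>x. max 0 (f x)"
  let ?e = "\<lambda>g (x, y). b x y * \<bar>g x - g y\<bar> powr p"
  let ?L = "\<lambda>(x, y). b x y * (\<bar>f x - f y\<bar> powr (p - 2) * (f x - f y)) * (?u x - ?u y)"
  have b: "0 \<le> b x y" and m: "0 \<le> m x" for x y
    using graph by (auto simp: weighted_graph_def less_imp_le)
  have f: "f \<in> energy_domain b m p" using ws by (simp add: weak_solution_def)
  have u: "?u \<in> energy_domain b m p"
    using p b m by (intro energy_domain_contraction[OF f]) auto
  have sum_e: "?e g summable_on UNIV"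
      "ennreal (infsum (?e g) UNIV) = (\<Sum>\<^sub>\<infinity>(x, y)\<in>UNIV. ennreal (b x y * \<bar>g x - g y\<bar> powr p))"
    if "g \<in> energy_domain b m p" for g
    using summable_on_if_infsum_ennreal_finite[of UNIV "?e g"] that b
    by (auto simp: energy_domain_iff case_prod_unfold)
  have fin: "(\<Sum>\<^sub>\<infinity>x. ennreal (?u x powr p * m x)) < \<infinity>"
    using u by (simp add: energy_domain_iff)
  then show "(\<Sum>\<^sub>\<infinity>x. ennreal (?u x powr p * m x)) < \<infinity>" .
  have sum_m: "ennreal (\<Sum>\<^sub>\<infinity>x. ?u x powr p * m x) = (\<Sum>\<^sub>\<infinity>x. ennreal (?u x powr p * m x))"
    using m fin by (intro summable_on_if_infsum_ennreal_finite(2)) auto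
  have L: "?e ?u z \<le> ?L z" "?L z \<le> ?e f z" for z
    using positive_part_powr_bounds[OF p, of "f (fst z)" "f (snd z)"] b[of "fst z" "snd z"]
    by (auto simp: case_prod_unfold mult.assoc intro!: mult_left_mono)
  have "0 \<le> ?e ?u z" for z using b by (simp add: case_prod_unfold)
  then have nonneg: "0 \<le> ?L z" for z using L(1)[of z] by (rule order_trans)
  \<comment> \<open>Without summability, \<open>infsum ?L UNIV\<close> would be the default
    \<open>0\<close> and could not be compared with the energy of \<open>?u\<close>.\<close>
  have sum_L: "?L summable_on UNIV"
    using L(2) nonneg by (intro summable_on_comparison_test[OF sum_e(1)[OF f]]) auto
  have "infsum (?e ?u) UNIV \<le> infsum ?L UNIV"
    by (intro infsum_mono sum_e(1)[OF u] sum_L L(1))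
  also have "infsum ?L UNIV = 2 * lam * (\<Sum>\<^sub>\<infinity>x. \<bar>f x\<bar> powr (p - 2) * f x * ?u x * m x)"
    using ws u by (simp add: weak_solution_def)
  also have "(\<Sum>\<^sub>\<infinity>x. \<bar>f x\<bar> powr (p - 2) * f x * ?u x * m x) = (\<Sum>\<^sub>\<infinity>x. ?u x powr p * m x)"
  proof (rule infsum_cong)
    show "\<bar>f x\<bar> powr (p - 2) * f x * ?u x * m x = ?u x powr p * m x" for x
      using abs_powr_diff2_mult[of "f x" p] by (auto simp: max_def)
  qed
  finally have "ennreal (infsum (?e ?u) UNIV) \<le> ennreal (2 * lam * (\<Sum>\<^sub>\<infinity>x. ?u x powr p * m x))"
    by (rule ennreal_leI)
  also have "\<dots> = ennreal (2 * lam) * (\<Sum>\<^sub>\<infinity>x. ennreal (?u x powr p * m x))"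
    using lam m by (subst ennreal_mult) (auto simp: sum_m intro!: infsum_nonneg)
  finally show "(\<Sum>\<^sub>\<infinity>(x, y)\<in>UNIV. ennreal (b x y * \<bar>?u x - ?u y\<bar> powr p)) \<le>
      ennreal (2 * lam) * (\<Sum>\<^sub>\<infinity>x. ennreal (?u x powr p * m x))"
    by (simp only: sum_e(2)[OF u])
qed

text \<open>If \<open>f \<le> 0\<close> everywhere, testing with \<open>1\<close> makes the sum of
  the non-negative terms \<open>\<bar>f x\<bar> powr (p - 1) * m x\<close> vanish, so
  \<open>f\<close> is identically \<open>0\<close> and hence constant.\<close>

lemma weak_solution_takes_positive_value:
  fixes f :: "'a::countable \<Rightarrow> real"
  assumes graph: "weighted_graph b m" and fin: "vmeasure m UNIV < \<infinity>" and p: "1 < p"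
    and lam: "lam \<noteq> 0" and ws: "weak_solution b m p lam f" and nc: "\<not> f constant_on UNIV"
  shows "\<exists>x. 0 < f x"
proof (rule ccontr)
  assume "\<not> ?thesis"
  then have neg: "f x \<le> 0" for x by (simp add: not_less)
  let ?s = "\<lambda>x. \<bar>f x\<bar> powr (p - 2) * - f x * m x"
  have m: "0 < m x" for x using graph by (auto simp: weighted_graph_def)
  have f: "f \<in> energy_domain b m p" using ws by (simp add: weak_solution_def)
  have s0: "0 \<le> ?s x" for x using neg[of x] m[of x] by (intro mult_nonneg_nonneg) auto
  have eq: "?s x = \<bar>f x\<bar> powr (p - 1) * m x" for x
  proof (cases "f x = 0")
    case False
    then have "\<bar>f x\<bar> powr (p - 2) * - f x = \<bar>f x\<bar> powr (p - 2) * \<bar>f x\<bar> powr 1"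
      using neg[of x] by simp
    also have "\<dots> = \<bar>f x\<bar> powr (p - 1)" by (simp only: powr_add[symmetric]) simp
    finally show ?thesis by simp
  qed simp
  have "?s summable_on UNIV"
  proof (rule summable_on_if_infsum_ennreal_finite(1))
    \<comment> \<open>On a finite measure space this reduces the exponent \<open>p - 1\<close> to
      \<open>p\<close>. Summability ensures that a vanishing \<open>infsum\<close> really forces all
      terms to vanish.\<close>
    have le: "\<bar>f x\<bar> powr (p - 1) \<le> 1 + \<bar>f x\<bar> powr p" for x
    proof (cases "\<bar>f x\<bar> \<le> 1")
      case True
      then have "\<bar>f x\<bar> powr (p - 1) \<le> 1" using p by (intro powr_le1) auto
      then show ?thesis by (simp add: add_increasing2)
    next
      case False
      then have "\<bar>f x\<bar> powr (p - 1) \<le> \<bar>f x\<bar> powr p" by (intro powr_mono) auto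
      then show ?thesis by simp
    qed
    have "(\<Sum>\<^sub>\<infinity>x. ennreal (?s x))
        \<le> (\<integral>\<^sup>+x. ennreal (m x) + ennreal (\<bar>f x\<bar> powr p * m x) \<partial>count_space UNIV)"
      unfolding infsum_eq_nn_integral_count_space[OF countableI_type]
    proof (rule nn_integral_mono)
      fix x
      have "?s x \<le> (1 + \<bar>f x\<bar> powr p) * m x"
        unfolding eq using le m[of x] by (intro mult_right_mono) auto
      then have "ennreal (?s x) \<le> ennreal (m x + \<bar>f x\<bar> powr p * m x)"
        by (intro ennreal_leI) (simp add: distrib_right)
      also have "\<dots> = ennreal (m x) + ennreal (\<bar>f x\<bar> powr p * m x)"
        using m[of x] by (intro ennreal_plus) auto
      finally show "ennreal (?s x) \<le> ennreal (m x) + ennreal (\<bar>f x\<bar> powr p * m x)" .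
    qed
    also have "\<dots> = vmeasure m UNIV + (\<Sum>\<^sub>\<infinity>x. ennreal (\<bar>f x\<bar> powr p * m x))"
      by (simp add: vmeasure_def infsum_eq_nn_integral_count_space nn_integral_add)
    also have "\<dots> < \<infinity>"
      using fin f by (simp add: energy_domain_iff)
    finally show "(\<Sum>\<^sub>\<infinity>x. ennreal (?s x)) < \<infinity>" .
  qed (rule s0)
  moreover have "(\<Sum>\<^sub>\<infinity>x. ?s x) = 0"
  proof -
    have "lam * (\<Sum>\<^sub>\<infinity>x. \<bar>f x\<bar> powr (p - 2) * f x * m x) = 0"
      using ws const_in_energy_domain[OF fin, of b p]
      by (force simp: weak_solution_def case_prod_unfold)
    then have "(\<Sum>\<^sub>\<infinity>x. \<bar>f x\<bar> powr (p - 2) * f x * m x) = 0" using lam by simp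
    then show ?thesis by (simp add: infsum_uminus)
  qed
  ultimately have "?s x = 0" for x
    using s0 by (intro nonneg_infsum_le_0D[of ?s UNIV]) auto
  then have "f x = 0" for x
    using m[of x] by (metis eq abs_eq_0 less_irrefl mult_eq_0_iff powr_eq_0_iff)
  then show False using nc by (auto simp: constant_on_def)
qed

text \<open>Testing with \<open>f\<close> itself shows that \<open>f\<close> agrees at the two ends
  of every edge with \<open>b x y > 0\<close>, so its level sets have no boundary, whatever
  \<open>d\<close> is.\<close>

lemma h1_eq_0_of_weak_solution_0:
  fixes f :: "'a::countable \<Rightarrow> real"
  assumes graph: "weighted_graph b m" and fin: "vmeasure m UNIV < \<infinity>"
    and ws: "weak_solution b m p 0 f" and nc: "\<not> f constant_on UNIV"
  shows "h1 b m d = 0"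
proof -
  let ?e = "\<lambda>z. b (fst z) (snd z) * \<bar>f (fst z) - f (snd z)\<bar> powr p"
  have b: "0 \<le> b x y" for x y using graph by (auto simp: weighted_graph_def)
  have f: "f \<in> energy_domain b m p" using ws by (simp add: weak_solution_def)
  have "?e summable_on UNIV"
    using f b by (intro summable_on_if_infsum_ennreal_finite(1))
      (auto simp: energy_domain_iff case_prod_unfold)
  moreover have "infsum ?e UNIV = 0"
  proof -
    have "infsum ?e UNIV = (\<Sum>\<^sub>\<infinity>z. b (fst z) (snd z) * (\<bar>f (fst z) - f (snd z)\<bar> powr (p - 2) *
        (f (fst z) - f (snd z))) * (f (fst z) - f (snd z)))"
    proof (rule infsum_cong)
      show "?e z = b (fst z) (snd z) * (\<bar>f (fst z) - f (snd z)\<bar> powr (p - 2) *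
          (f (fst z) - f (snd z))) * (f (fst z) - f (snd z))" for z
        using abs_powr_diff2_mult[of "f (fst z) - f (snd z)" p] by (simp only: mult.assoc)
    qed
    also have "\<dots> = 0" using ws f by (simp add: weak_solution_def case_prod_unfold)
    finally show ?thesis .
  qed
  ultimately have "?e z = 0" for z
    using b by (intro nonneg_infsum_le_0D[of ?e UNIV]) auto
  from this[of "(_, _)"] have b0: "b x y = 0" if "f x \<noteq> f y" for x y
    using that by (metis (no_types) abs_eq_0 eq_iff_diff_eq_0 fst_conv mult_eq_0_iff powr_eq_0_iff snd_conv)
  obtain x0 y0 where xy: "f x0 < f y0"
    using nc unfolding constant_on_def by (metis linorder_less_linear)
  let ?W = "{x. f x0 < f x}"
  \<comment> \<open>Both \<open>?W\<close> and its complement are non-empty, containing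
    \<open>y0\<close> and \<open>x0\<close> respectively, so whichever has at most half the mass is
    a competitor in \<open>h1\<close>.\<close>
  obtain V where V: "V = ?W \<or> V = - ?W" "vmeasure m V \<le> vmeasure m UNIV / 2"
    using vmeasure_disjoint_half[OF _ fin, of ?W "- ?W"] by blast
  have "V \<noteq> {}" using V(1) xy by auto
  moreover have "boundary_size b d V = 0"
    unfolding boundary_size_def edge_boundary_def using V(1) b0
    by (intro infsum_0) fastforce
  ultimately have "h1 b m d \<le> 0 / vmeasure m V"
    unfolding h1_def using V(2) by (intro INF_lower2[of V]) auto
  then show ?thesis by simp
qed

text \<open>The energy estimate is applied to the positive part of \<open>f\<close>. Its norm is not
  zero because \<open>f\<close> is positive at some vertex, and every vertex has positive
  mass.\<close>

lemma h1_le_of_weak_solution: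
  fixes f :: "'a::countable \<Rightarrow> real"
  assumes graph: "weighted_graph b m" and fin: "vmeasure m UNIV < \<infinity>" and p: "1 < p"
    and lam: "0 < lam" and ws: "weak_solution b m p lam f" and pos: "\<exists>x. 0 < f x"
    and half: "vmeasure m {x. 0 < f x} \<le> vmeasure m UNIV / 2" and d: "d \<in> R_weights b m p"
  shows "h1 b m d \<le> ennreal (p / 2 * (2 * lam) powr (1 / p))"
proof (rule h1_le_of_energy_bound[OF graph fin p lam _ d, where u = "\<lambda>x. max 0 (f x)"])
  show "vmeasure m {x. 0 < max 0 (f x)} \<le> vmeasure m UNIV / 2"
    using half by (simp add: less_max_iff_disj)
  show "(\<Sum>\<^sub>\<infinity>x. ennreal (max 0 (f x) powr p * m x)) \<noteq> 0"
  proof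
    assume "(\<Sum>\<^sub>\<infinity>x. ennreal (max 0 (f x) powr p * m x)) = 0"
    then have "ennreal (max 0 (f x) powr p * m x) = 0" for x
      by (simp add: infsum_eq_nn_integral_count_space nn_integral_0_iff_AE AE_count_space)
    moreover obtain x where "0 < f x" using pos by blast
    moreover have "0 < m x" using graph by (simp add: weighted_graph_def)
    ultimately show False
      by (metis ennreal_eq_0_iff max_def less_imp_le mult_pos_pos not_le powr_gt_zero less_irrefl)
  qed
  show "(\<Sum>\<^sub>\<infinity>x. ennreal (max 0 (f x) powr p * m x)) \<noteq> \<infinity>"
    using weak_solution_positive_part_energy(2)[OF graph p _ ws] lam by simp
  show "(\<Sum>\<^sub>\<infinity>(x, y)\<in>UNIV. ennreal (b x y * \<bar>max 0 (f x) - max 0 (f y)\<bar> powr p)) \<le>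
      ennreal (2 * lam) * (\<Sum>\<^sub>\<infinity>x. ennreal (max 0 (f x) powr p * m x))"
    using weak_solution_positive_part_energy(1)[OF graph p _ ws] lam by simp
qed auto

section \<open>From the bound on each \<open>h1\<close> to the bound on \<open>h1p\<close>\<close>

lemma ennpowr_le:
  assumes "x \<le> ennreal c" "0 \<le> c" "0 \<le> r"
  shows "x ennpowr r \<le> ennreal (c powr r)"
proof -
  have "x \<noteq> \<infinity>" using assms(1) by (auto simp: top_unique)
  moreover have "enn2real x \<le> c"
    using assms(1,2) by (simp add: enn2real_leI)
  ultimately show ?thesis
    using assms by (auto simp: ennpowr_def intro!: ennreal_leI powr_mono2)
qed

theorem theorem3p2:
  fixes b :: "'a::countable \<Rightarrow> 'a \<Rightarrow> real" and m :: "'a \<Rightarrow> real" and p :: real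
  assumes "weighted_graph b m"
    and "vmeasure m UNIV < \<infinity>"
    and "1 < p"
    and "\<exists>f. \<not> f constant_on UNIV \<and> weak_solution b m p (enn2real (lambda1 b m p)) f"
  shows "ennreal (2 powr (p - 1) / p powr p) * (h1p b m p ennpowr p) \<le> lambda1 b m p"
proof (cases "lambda1 b m p = \<infinity>")
  case True
  then show ?thesis by simp
next
  case False
  define lam where "lam = enn2real (lambda1 b m p)"
  \<comment> \<open>The bound obtained on every \<open>h1 b m d\<close>; solving
    \<open>2 powr (p - 1) / p powr p * c powr p = lam\<close> for \<open>c\<close> gives the same
    value.\<close>
  define c where "c = p / 2 * (2 * lam) powr (1 / p)"
  have lam: "lambda1 b m p = ennreal lam" "0 \<le> lam"
    using False by (auto simp: lam_def less_top)
  have c: "0 \<le> c" using assms(3) by (simp add: c_def)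
  obtain f where nc: "\<not> f constant_on UNIV" and ws: "weak_solution b m p lam f"
    using assms(4) by (auto simp: lam_def)
  have "h1 b m d \<le> ennreal c" if d: "d \<in> R_weights b m p" for d
  proof (cases "lam = 0")
    case True
    then show ?thesis
      using h1_eq_0_of_weak_solution_0[OF assms(1,2) _ nc] ws by simp
  next
    case False
    with lam(2) have pos: "0 < lam" by simp
    \<comment> \<open>Both \<open>f\<close> and \<open>?g\<close> take positive values, and at least
      one of them does so on at most half of the mass; the estimate is used for that one.\<close>
    let ?g = "\<lambda>x. - f x"
    have wsg: "weak_solution b m p lam ?g" by (rule weak_solution_uminus[OF ws])
    have ncg: "\<not> ?g constant_on UNIV"
      using nc by (auto simp: constant_on_def) (metis minus_minus)
    note sign = weak_solution_takes_positive_value[OF assms(1-3) False]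
    have "vmeasure m {x. 0 < f x} \<le> vmeasure m UNIV / 2 \<or> vmeasure m {x. 0 < ?g x} \<le> vmeasure m UNIV / 2"
      by (rule vmeasure_disjoint_half[OF _ assms(2)]) auto
    then show ?thesis
      unfolding c_def
      using h1_le_of_weak_solution[OF assms(1-3) pos ws sign[OF ws nc] _ d]
        h1_le_of_weak_solution[OF assms(1-3) pos wsg sign[OF wsg ncg] _ d] by blast
  qed
  then have "h1p b m p \<le> ennreal c"
    unfolding h1p_def by (rule SUP_least)
  then have "ennreal (2 powr (p - 1) / p powr p) * (h1p b m p ennpowr p)
      \<le> ennreal (2 powr (p - 1) / p powr p) * ennreal (c powr p)"
    using c assms(3) by (intro mult_left_mono ennpowr_le) auto
  also have "\<dots> = ennreal (2 powr (p - 1) / p powr p * c powr p)"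
    by (rule ennreal_mult[symmetric]) auto
  also have "2 powr (p - 1) / p powr p * c powr p = lam"
  proof -
    have "c powr p = p powr p / 2 powr p * (2 * lam)"
      using assms(3) lam(2) by (simp add: c_def powr_mult powr_divide powr_powr)
    then show ?thesis
      using assms(3) by (simp add: powr_diff)
  qed
  finally show ?thesis by (simp add: lam(1))
qed

end
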